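(* Let $f(s)$ be an almost periodic function in an open vertical strip $U=\{\sigma+it\in\mathbb{C}:\alpha<\sigma<\beta\}$, where $-\infty\le\alpha<\beta\le\infty$, and let $\sigma_0\in(\alpha,\beta)$. Then $\sigma_0\in R_f$ if and only if there exists a sequence $\{t_j\}_{j=1,2,\ldots}$ of real numbers such that $$\lim_{j\to\infty} f(\sigma_0+it_j)=0.$$
   Context: Write $s=\sigma+it$ with $\sigma,t\in\mathbb{R}$. A function $f$, analytic in the vertical strip $U=\{\sigma+it:\alpha<\sigma<\beta\}$, is called almost periodic in $U$ if for every reduced strip $\{\alpha_1\le\sigma\le\beta_1\}$ with $\alpha<\alpha_1<\beta_1<\beta$ and every $\varepsilon>0$ there is $l>0$ such that each interval of length $l$ on the real line contains a number $\tau$ with $|f(s+i\tau)-f(s)|\le\varepsilon$ for all $s$ in the reduced strip. Equivalently, $f$ is a uniform limit, on every reduced strip of $U$, of exponential polynomials $a_1e^{\lambda_1s}+\cdots+a_ne^{\lambda_ns}$ with $a_j\in\mathbb{C}$, $\lambda_j\in\mathbb{R}$. The set $R_f$ is defined by $R_f:=\overline{\{\operatorname{Re}s: f(s)=0,\ s\in U\}}\cap(\alpha,\beta)$, where the bar denotes closure in $\mathbb{R}$. *)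

theory Defs
  imports "HOL-Complex_Analysis.Complex_Analysis"
begin

text \<open>The endpoints are extended reals, so half-planes and the whole plane are included.\<close>

definition vertical_strip :: "ereal \<Rightarrow> ereal \<Rightarrow> complex set" where
  "vertical_strip \<alpha> \<beta> = {s. \<alpha> < ereal (Re s) \<and> ereal (Re s) < \<beta>}"

definition almost_periodic_in_strip :: "(complex \<Rightarrow> complex) \<Rightarrow> ereal \<Rightarrow> ereal \<Rightarrow> bool" where
  "almost_periodic_in_strip f \<alpha> \<beta> \<longleftrightarrow>
     f analytic_on vertical_strip \<alpha> \<beta> \<and>
     (\<forall>\<alpha>\<^sub>1 \<beta>\<^sub>1 :: real. \<alpha> < ereal \<alpha>\<^sub>1 \<and> \<alpha>\<^sub>1 < \<beta>\<^sub>1 \<and> ereal \<beta>\<^sub>1 < \<beta> \<longrightarrow>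
        (\<forall>\<epsilon>>0. \<exists>l>0. \<forall>a::real. \<exists>\<tau>\<in>{a..a + l}.
           \<forall>s. \<alpha>\<^sub>1 \<le> Re s \<and> Re s \<le> \<beta>\<^sub>1 \<longrightarrow>
             cmod (f (s + \<i> * complex_of_real \<tau>) - f s) \<le> \<epsilon>))"

definition R_set :: "(complex \<Rightarrow> complex) \<Rightarrow> ereal \<Rightarrow> ereal \<Rightarrow> real set" where
  "R_set f \<alpha> \<beta> =
     closure (Re ` {s \<in> vertical_strip \<alpha> \<beta>. f s = 0}) \<inter> {x. \<alpha> < ereal x \<and> ereal x < \<beta>}"

end

theory Submission
  imports Defs
begin

text \<open>
  An almost period moves any point of a closed strip into a rectangle of bounded height with
  little change of the value, so \<open>f\<close> is bounded and uniformly continuous there. Uniform continuity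
  turns zeros \<open>s\<^sub>j\<close> with \<open>Re s\<^sub>j \<longlonglongrightarrow> \<sigma>\<^sub>0\<close> into small values at \<open>\<sigma>\<^sub>0 + \<i> Im s\<^sub>j\<close>.

  Conversely, suppose that \<open>f (\<sigma>\<^sub>0 + \<i> t\<^sub>j) \<longlonglongrightarrow> 0\<close> and that \<open>f\<close> has no zeros near the line
  \<open>Re s = \<sigma>\<^sub>0\<close>. By Montel's theorem a subsequence of the translates \<open>f (s + \<i> t\<^sub>j)\<close> converges
  locally uniformly to some \<open>g\<close> with \<open>g \<sigma>\<^sub>0 = 0\<close>, and Hurwitz's theorem forces \<open>g = 0\<close>. Hence \<open>f\<close> is
  uniformly small on arbitrarily long pieces of the line; translating by almost periods, it
  vanishes on the whole line, a contradiction.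
\<close>

text \<open>Keeps only what one fixed closed strip with finite edges provides. Holomorphy is assumed
  separately, on the open interior, where Montel's and Hurwitz's theorems are applied.\<close>

locale almost_periodic_closed_strip =
  fixes f :: "complex \<Rightarrow> complex" and a b :: real
  assumes continuous: "continuous_on {s. a \<le> Re s \<and> Re s \<le> b} f"
    and almost_period: "\<And>\<epsilon>. \<epsilon> > 0 \<Longrightarrow> \<exists>l>0. \<forall>c::real. \<exists>\<tau>\<in>{c..c + l}.
      \<forall>s. a \<le> Re s \<and> Re s \<le> b \<longrightarrow> cmod (f (s + \<i> * complex_of_real \<tau>) - f s) \<le> \<epsilon>"
begin

section \<open>Boundedness and uniform continuity on the closed strip\<close>

lemma continuous_on_rectangle: "continuous_on (cbox (Complex a c) (Complex b d)) f"
  by (rule continuous_on_subset[OF continuous]) (auto simp: in_cbox_complex_iff)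

lemma bounded_image: "bounded (f ` {s. a \<le> Re s \<and> Re s \<le> b})"
proof -
  obtain l where l: "\<And>c. \<exists>\<tau>\<in>{c..c + l}. \<forall>s. a \<le> Re s \<and> Re s \<le> b \<longrightarrow>
      cmod (f (s + \<i> * complex_of_real \<tau>) - f s) \<le> 1"
    using almost_period[of 1] by auto
  have "compact (f ` cbox (Complex a 0) (Complex b l))"
    by (intro compact_continuous_image continuous_on_rectangle compact_cbox)
  then obtain M where M: "\<And>s. s \<in> cbox (Complex a 0) (Complex b l) \<Longrightarrow> cmod (f s) \<le> M"
    by (metis compact_imp_bounded bounded_iff imageI)
  have "cmod (f s) \<le> M + 1" if s: "a \<le> Re s" "Re s \<le> b" for s
  proof -
    \<comment> \<open>This window of length \<open>l\<close> brings \<open>s\<close> to a height in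
      \<open>{0..l}\<close>, where the bound \<open>M\<close> applies; the move costs at most
      1.\<close>
    obtain \<tau> where \<tau>: "\<tau> \<in> {- Im s..- Im s + l}"
        "cmod (f (s + \<i> * complex_of_real \<tau>) - f s) \<le> 1"
      using l[of "- Im s"] s by blast
    have "cmod (f (s + \<i> * complex_of_real \<tau>)) \<le> M"
      using \<tau>(1) s by (intro M) (auto simp: in_cbox_complex_iff)
    then show ?thesis
      using \<tau>(2) norm_triangle_ineq2[of "f s" "f (s + \<i> * complex_of_real \<tau>)"]
      by (simp add: norm_minus_commute)
  qed
  then show ?thesis
    by (auto simp: bounded_iff)
qed

lemma uniformly_continuous: "uniformly_continuous_on {s. a \<le> Re s \<and> Re s \<le> b} f"
  unfolding uniformly_continuous_on_def
proof (intro allI impI)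
  fix e :: real
  assume "e > 0"
  then obtain l where l: "\<And>c. \<exists>\<tau>\<in>{c..c + l}. \<forall>s. a \<le> Re s \<and> Re s \<le> b \<longrightarrow>
      cmod (f (s + \<i> * complex_of_real \<tau>) - f s) \<le> e / 3"
    using almost_period[of "e / 3"] by auto
  \<comment> \<open>The shift below takes \<open>s\<close> to a height between 1 and
    \<open>l + 1\<close>. The margin of 1 at either end keeps \<open>s'\<close> in \<open>R\<close>
    as well, which is why distances are also restricted to be less than 1.\<close>
  define R where "R = cbox (Complex a 0) (Complex b (l + 2))"
  have "uniformly_continuous_on R f"
    unfolding R_def by (intro compact_uniformly_continuous continuous_on_rectangle compact_cbox)
  then obtain d where d: "d > 0"
      "\<And>s s'. s \<in> R \<Longrightarrow> s' \<in> R \<Longrightarrow> dist s' s < d \<Longrightarrow> dist (f s') (f s) < e / 3"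
    unfolding uniformly_continuous_on_def using \<open>e > 0\<close> by (metis divide_pos_pos zero_less_numeral)
  have "dist (f s') (f s) < e"
    if s: "a \<le> Re s" "Re s \<le> b" "a \<le> Re s'" "Re s' \<le> b" and dist: "dist s' s < min d 1" for s s'
  proof -
    obtain \<tau> where \<tau>: "\<tau> \<in> {1 - Im s..1 - Im s + l}"
        and close: "\<And>z. a \<le> Re z \<Longrightarrow> Re z \<le> b \<Longrightarrow> cmod (f (z + \<i> * complex_of_real \<tau>) - f z) \<le> e / 3"
      using l[of "1 - Im s"] by blast
    have "\<bar>Im s' - Im s\<bar> < 1"
      using abs_Im_le_cmod[of "s' - s"] dist by (simp add: dist_norm)
    then have "s + \<i> * complex_of_real \<tau> \<in> R" "s' + \<i> * complex_of_real \<tau> \<in> R"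
      using \<tau> s by (auto simp: R_def in_cbox_complex_iff)
    then have "dist (f (s' + \<i> * complex_of_real \<tau>)) (f (s + \<i> * complex_of_real \<tau>)) < e / 3"
      using dist by (intro d(2)) auto
    moreover have "dist (f (s + \<i> * complex_of_real \<tau>)) (f s) \<le> e / 3"
        "dist (f (s' + \<i> * complex_of_real \<tau>)) (f s') \<le> e / 3"
      using close s by (auto simp: dist_norm)
    ultimately show ?thesis
      by metric
  qed
  then show "\<exists>d>0. \<forall>s\<in>{s. a \<le> Re s \<and> Re s \<le> b}. \<forall>s'\<in>{s. a \<le> Re s \<and> Re s \<le> b}.
      dist s' s < d \<longrightarrow> dist (f s') (f s) < e"
    using d(1) by (intro exI[of _ "min d 1"]) auto
qed

section \<open>Limits of vertical translates\<close>

lemma translates_convergent_subsequence: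
  fixes t :: "nat \<Rightarrow> real"
  assumes holo: "f holomorphic_on {s. a < Re s \<and> Re s < b}"
  obtains g r where "g holomorphic_on {s. a < Re s \<and> Re s < b}" "strict_mono (r :: nat \<Rightarrow> nat)"
    "\<And>K. compact K \<Longrightarrow> K \<subseteq> {s. a < Re s \<and> Re s < b} \<Longrightarrow>
       uniform_limit K (\<lambda>n s. f (s + \<i> * complex_of_real (t (r n)))) g sequentially"
proof -
  let ?S = "{s. a < Re s \<and> Re s < b}"
  let ?F = "\<lambda>n s. f (s + \<i> * complex_of_real (t n))"
  obtain M where M: "\<And>s. a \<le> Re s \<Longrightarrow> Re s \<le> b \<Longrightarrow> cmod (f s) \<le> M"
    using bounded_image by (auto simp: bounded_iff)
  have "open ?S"
    by (simp add: open_Collect_conj open_halfspace_Re_gt open_halfspace_Re_lt)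
  then show thesis
  proof (rule Montel[where \<H> = "range ?F" and \<F> = ?F])
    fix h assume "h \<in> range ?F"
    then obtain n where n: "h = ?F n"
      by blast
    have "(f \<circ> (\<lambda>s. s + \<i> * complex_of_real (t n))) holomorphic_on ?S"
      by (rule holomorphic_on_compose_gen[OF _ holo]) (auto intro!: holomorphic_intros)
    then show "h holomorphic_on ?S"
      by (simp add: n o_def)
  next
    \<comment> \<open>Vertical translation preserves the strip, so the bound on \<open>f\<close>
      serves all translates at once.\<close>
    fix K assume "K \<subseteq> ?S"
    then show "\<exists>B. \<forall>h\<in>range ?F. \<forall>z\<in>K. cmod (h z) \<le> B"
      by (intro exI[of _ M]) (fastforce intro!: M)
  next
    fix g r
    assume "g holomorphic_on ?S" "strict_mono (r :: nat \<Rightarrow> nat)"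
      and "\<And>K. compact K \<Longrightarrow> K \<subseteq> ?S \<Longrightarrow> uniform_limit K (?F \<circ> r) g sequentially"
    then show thesis
      by (intro that[of g r]) (auto simp: o_def)
  qed auto
qed

text \<open>Small values along the line yield a limit of translates that vanishes at \<sigma>. Since
  the translates have no zeros, Hurwitz's theorem makes this limit identically zero, and an almost
  period carries the smallness back to \<sigma> itself.\<close>

lemma nonzero_on_strip_imp_not_tendsto_0:
  fixes t :: "nat \<Rightarrow> real"
  assumes holo: "f holomorphic_on {s. a < Re s \<and> Re s < b}"
    and nz: "\<And>s. a < Re s \<Longrightarrow> Re s < b \<Longrightarrow> f s \<noteq> 0"
    and \<sigma>: "a < \<sigma>" "\<sigma> < b"
  shows "\<not> (\<lambda>j. f (complex_of_real \<sigma> + \<i> * complex_of_real (t j))) \<longlonglongrightarrow> 0"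
proof
  assume lim: "(\<lambda>j. f (complex_of_real \<sigma> + \<i> * complex_of_real (t j))) \<longlonglongrightarrow> 0"
  let ?S = "{s. a < Re s \<and> Re s < b}"
  obtain g r where g: "g holomorphic_on ?S" and r: "strict_mono (r :: nat \<Rightarrow> nat)"
    and ul: "\<And>K. compact K \<Longrightarrow> K \<subseteq> ?S \<Longrightarrow>
      uniform_limit K (\<lambda>n s. f (s + \<i> * complex_of_real (t (r n)))) g sequentially"
    using translates_convergent_subsequence[OF holo, of t] by blast
  have \<sigma>_in: "complex_of_real \<sigma> \<in> ?S"
    using \<sigma> by simp
  have "open ?S"
    by (simp add: open_Collect_conj open_halfspace_Re_gt open_halfspace_Re_lt)
  have "?S = {s. a < Re s} \<inter> {s. Re s < b}"
    by auto
  then have "connected ?S"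
    by (simp add: convex_connected convex_Int convex_halfspace_Re_gt convex_halfspace_Re_lt)
  \<comment> \<open>Uniform convergence on a single point is convergence there.\<close>
  have "(\<lambda>n. f (complex_of_real \<sigma> + \<i> * complex_of_real (t (r n)))) \<longlonglongrightarrow> g (complex_of_real \<sigma>)"
    using ul[of "{complex_of_real \<sigma>}"] \<sigma>_in by simp
  moreover have "(\<lambda>n. f (complex_of_real \<sigma> + \<i> * complex_of_real (t (r n)))) \<longlonglongrightarrow> 0"
    using LIMSEQ_subseq_LIMSEQ[OF lim r] by (simp add: o_def)
  ultimately have g_\<sigma>: "g (complex_of_real \<sigma>) = 0"
    by (rule LIMSEQ_unique)
  have "g constant_on ?S"
  proof (rule ccontr)
    assume nonconst: "\<not> g constant_on ?S"
    have "g (complex_of_real \<sigma>) \<noteq> 0"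
    proof (rule Hurwitz_no_zeros[OF \<open>open ?S\<close> \<open>connected ?S\<close> _ g ul nonconst _ \<sigma>_in])
      fix n
      have "(f \<circ> (\<lambda>s. s + \<i> * complex_of_real (t (r n)))) holomorphic_on ?S"
        by (rule holomorphic_on_compose_gen[OF _ holo]) (auto intro!: holomorphic_intros)
      then show "(\<lambda>s. f (s + \<i> * complex_of_real (t (r n)))) holomorphic_on ?S"
        by (simp add: o_def)
    next
      show "f (s + \<i> * complex_of_real (t (r n))) \<noteq> 0" if "s \<in> ?S" for n s
        using that by (intro nz) auto
    qed
    with g_\<sigma> show False
      by simp
  qed
  with g_\<sigma> \<sigma>_in have g0: "g s = 0" if "s \<in> ?S" for s
    using that unfolding constant_on_def by metis
  \<comment> \<open>One zero already contradicts \<open>nz\<close>, so the value at \<sigma> alone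
    is estimated.\<close>
  have "cmod (f (complex_of_real \<sigma>)) \<le> 0 + e" if "e > 0" for e
  proof -
    from \<open>e > 0\<close> obtain l where l: "\<And>c. \<exists>\<tau>\<in>{c..c + l}. \<forall>s. a \<le> Re s \<and> Re s \<le> b \<longrightarrow>
        cmod (f (s + \<i> * complex_of_real \<tau>) - f s) \<le> e / 2"
      using almost_period[of "e / 2"] by auto
    \<comment> \<open>The length \<open>l\<close> is fixed before \<open>n\<close>: \<open>K\<close>
      holds every height \<open>\<tau> - t (r n)\<close> that can occur for an almost period from a
      window starting at \<open>t (r n)\<close>, whatever \<open>n\<close> is.\<close>
    define K where "K = cbox (Complex \<sigma> 0) (Complex \<sigma> l)"
    have K: "compact K" "K \<subseteq> ?S"
      using \<sigma> by (auto simp: K_def in_cbox_complex_iff)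
    then obtain n where n: "\<And>s. s \<in> K \<Longrightarrow> cmod (f (s + \<i> * complex_of_real (t (r n)))) < e / 2"
      using uniform_limitD[OF ul[OF K], of "e / 2"] \<open>e > 0\<close> g0
      by (force simp: eventually_sequentially dist_norm subset_iff)
    obtain \<tau> where \<tau>: "\<tau> \<in> {t (r n)..t (r n) + l}"
        "cmod (f (complex_of_real \<sigma> + \<i> * complex_of_real \<tau>) - f (complex_of_real \<sigma>)) \<le> e / 2"
      using l[of "t (r n)"] \<sigma> by fastforce
    have "Complex \<sigma> (\<tau> - t (r n)) \<in> K"
      using \<tau>(1) by (auto simp: K_def in_cbox_complex_iff)
    moreover have "Complex \<sigma> (\<tau> - t (r n)) + \<i> * complex_of_real (t (r n)) =
        complex_of_real \<sigma> + \<i> * complex_of_real \<tau>"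
      by (simp add: complex_eq_iff)
    ultimately have "cmod (f (complex_of_real \<sigma> + \<i> * complex_of_real \<tau>)) < e / 2"
      using n by metis
    then show ?thesis
      using \<tau>(2) norm_triangle_ineq2[of "f (complex_of_real \<sigma>)" "f (complex_of_real \<sigma> + \<i> * complex_of_real \<tau>)"]
      by (simp add: norm_minus_commute)
  qed
  then have "cmod (f (complex_of_real \<sigma>)) \<le> 0"
    by (rule field_le_epsilon)
  with nz[of "complex_of_real \<sigma>"] \<sigma> show False
    by simp
qed

text \<open>Each zero is pushed horizontally onto the line. The heights may be unbounded, so the
  continuity has to be uniform on the strip.\<close>

lemma zeros_imp_tendsto_0:
  assumes zero: "\<And>n. f (s n) = 0" "\<And>n. a \<le> Re (s n)" "\<And>n. Re (s n) \<le> b"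
    and lim: "(\<lambda>n. Re (s n)) \<longlonglongrightarrow> \<sigma>" and \<sigma>: "a \<le> \<sigma>" "\<sigma> \<le> b"
  shows "(\<lambda>n. f (complex_of_real \<sigma> + \<i> * complex_of_real (Im (s n)))) \<longlonglongrightarrow> 0"
proof (rule tendstoI)
  fix e :: real
  assume "e > 0"
  then obtain d where d: "d > 0" "\<And>z z'. a \<le> Re z \<Longrightarrow> Re z \<le> b \<Longrightarrow> a \<le> Re z' \<Longrightarrow> Re z' \<le> b \<Longrightarrow>
      dist z' z < d \<Longrightarrow> dist (f z') (f z) < e"
    using uniformly_continuous unfolding uniformly_continuous_on_def by (auto; metis)
  have "\<forall>\<^sub>F n in sequentially. dist (Re (s n)) \<sigma> < d"
    using lim d(1) by (rule tendstoD)
  then show "\<forall>\<^sub>F n in sequentially. dist (f (complex_of_real \<sigma> + \<i> * complex_of_real (Im (s n)))) 0 < e"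
  proof eventually_elim
    case (elim n)
    have "complex_of_real \<sigma> + \<i> * complex_of_real (Im (s n)) - s n = complex_of_real (\<sigma> - Re (s n))"
      by (simp add: complex_eq_iff)
    then have "dist (complex_of_real \<sigma> + \<i> * complex_of_real (Im (s n))) (s n) < d"
      using elim by (simp only: dist_norm norm_of_real) (simp add: abs_minus_commute)
    then have "dist (f (complex_of_real \<sigma> + \<i> * complex_of_real (Im (s n)))) (f (s n)) < e"
      using zero \<sigma> by (intro d(2)) auto
    then show ?case
      by (simp add: zero)
  qed
qed

end

section \<open>Passage from the open strip to closed strips inside it, and the equivalence\<close>

lemma almost_periodic_closed_strip:
  assumes f: "almost_periodic_in_strip f \<alpha> \<beta>"
    and ab: "\<alpha> < ereal a" "a < b" "ereal b < \<beta>"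
  shows "almost_periodic_closed_strip f a b"
proof
  have "{s. a \<le> Re s \<and> Re s \<le> b} \<subseteq> vertical_strip \<alpha> \<beta>"
    using ab less_le_trans[of \<alpha> "ereal a"] le_less_trans[of _ "ereal b" \<beta>]
    by (simp add: vertical_strip_def subset_iff)
  then show "continuous_on {s. a \<le> Re s \<and> Re s \<le> b} f"
    using f unfolding almost_periodic_in_strip_def
    by (meson analytic_imp_holomorphic holomorphic_on_imp_continuous_on continuous_on_subset)
qed (use f ab in \<open>auto simp: almost_periodic_in_strip_def\<close>)

theorem theorem4:
  fixes f :: "complex \<Rightarrow> complex" and \<alpha> \<beta> :: ereal and \<sigma>\<^sub>0 :: real
  assumes "\<alpha> < \<beta>"
    and "almost_periodic_in_strip f \<alpha> \<beta>"
    and "\<alpha> < ereal \<sigma>\<^sub>0" and "ereal \<sigma>\<^sub>0 < \<beta>"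
  shows "\<sigma>\<^sub>0 \<in> R_set f \<alpha> \<beta> \<longleftrightarrow>
    (\<exists>t :: nat \<Rightarrow> real.
       (\<lambda>j. f (complex_of_real \<sigma>\<^sub>0 + \<i> * complex_of_real (t j))) \<longlonglongrightarrow> 0)"
proof -
  let ?Z = "Re ` {s \<in> vertical_strip \<alpha> \<beta>. f s = 0}"
  \<comment> \<open>The edges \<alpha> and \<beta> may be infinite, so real ones are interposed
    around \<open>\<sigma>\<^sub>0\<close>.\<close>
  obtain a where a: "\<alpha> < ereal a" "a < \<sigma>\<^sub>0"
    using ereal_dense2[OF assms(3)] by auto
  obtain b where b: "\<sigma>\<^sub>0 < b" "ereal b < \<beta>"
    using ereal_dense2[OF assms(4)] by auto
  show ?thesis
  proof
    interpret almost_periodic_closed_strip f a b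
      using a b assms(2) by (intro almost_periodic_closed_strip) auto
    assume "\<sigma>\<^sub>0 \<in> R_set f \<alpha> \<beta>"
    then have Z: "\<exists>y\<in>?Z. dist y \<sigma>\<^sub>0 < \<epsilon>" if "\<epsilon> > 0" for \<epsilon>
      using that closure_approachable[of \<sigma>\<^sub>0 ?Z] unfolding R_set_def by blast
    have "\<exists>y\<in>?Z \<inter> {a<..<b}. dist y \<sigma>\<^sub>0 < \<epsilon>" if "\<epsilon> > 0" for \<epsilon>
    proof -
      \<comment> \<open>A radius below the distances from \<open>\<sigma>\<^sub>0\<close> to
        \<open>a\<close> and \<open>b\<close> forces the nearby real part into the interval between
        them.\<close>
      have "min \<epsilon> (min (\<sigma>\<^sub>0 - a) (b - \<sigma>\<^sub>0)) > 0"
        using that a b by simp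
      from Z[OF this] obtain y where "y \<in> ?Z" "dist y \<sigma>\<^sub>0 < min \<epsilon> (min (\<sigma>\<^sub>0 - a) (b - \<sigma>\<^sub>0))"
        by blast
      then show ?thesis
        by (intro bexI[of _ y]) (auto simp: dist_real_def)
    qed
    then have "\<sigma>\<^sub>0 \<in> closure (?Z \<inter> {a<..<b})"
      by (simp only: closure_approachable) blast
    then obtain x where x: "\<And>n. x n \<in> ?Z \<inter> {a<..<b}" "x \<longlonglongrightarrow> \<sigma>\<^sub>0"
      unfolding closure_sequential by blast
    have "\<exists>s. Re s = x n \<and> f s = 0" for n
      using x(1)[of n] by auto
    \<comment> \<open>The imaginary parts of these zeros will serve as the sequence
      \<open>t\<close>.\<close>
    then obtain s where s: "\<And>n. Re (s n) = x n" "\<And>n. f (s n) = 0"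
      by metis
    have "(\<lambda>n. f (complex_of_real \<sigma>\<^sub>0 + \<i> * complex_of_real (Im (s n)))) \<longlonglongrightarrow> 0"
      using x s a b by (intro zeros_imp_tendsto_0) (auto simp: less_imp_le)
    then show "\<exists>t. (\<lambda>j. f (complex_of_real \<sigma>\<^sub>0 + \<i> * complex_of_real (t j))) \<longlonglongrightarrow> 0"
      by (rule exI[of _ "\<lambda>n. Im (s n)"])
  next
    assume "\<exists>t. (\<lambda>j. f (complex_of_real \<sigma>\<^sub>0 + \<i> * complex_of_real (t j))) \<longlonglongrightarrow> 0"
    then obtain t where t: "(\<lambda>j. f (complex_of_real \<sigma>\<^sub>0 + \<i> * complex_of_real (t j))) \<longlonglongrightarrow> 0"
      by blast
    have "\<sigma>\<^sub>0 \<in> closure ?Z"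
    proof (rule ccontr)
      assume "\<sigma>\<^sub>0 \<notin> closure ?Z"
      then obtain \<delta> where \<delta>: "\<delta> > 0" "\<And>y. y \<in> ?Z \<Longrightarrow> \<delta> \<le> dist y \<sigma>\<^sub>0"
        unfolding closure_approachable by (meson not_less)
      define c d where "c = max a (\<sigma>\<^sub>0 - \<delta>)" and "d = min b (\<sigma>\<^sub>0 + \<delta>)"
      have cd: "\<alpha> < ereal c" "c < \<sigma>\<^sub>0" "\<sigma>\<^sub>0 < d" "ereal d < \<beta>"
        using a b \<delta>(1) less_le_trans[of \<alpha> "ereal a" "ereal c"] le_less_trans[of "ereal d" "ereal b" \<beta>]
        by (simp_all add: c_def d_def)
      interpret almost_periodic_closed_strip f c d
        using cd assms(2) by (intro almost_periodic_closed_strip) auto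
      have strip: "s \<in> vertical_strip \<alpha> \<beta>" if "c < Re s" "Re s < d" for s
        using that cd less_trans[of \<alpha> "ereal c" "ereal (Re s)"] less_trans[of "ereal (Re s)" "ereal d" \<beta>]
        by (simp add: vertical_strip_def)
      then have "{s. c < Re s \<and> Re s < d} \<subseteq> vertical_strip \<alpha> \<beta>"
        by blast
      then have holo: "f holomorphic_on {s. c < Re s \<and> Re s < d}"
        using assms(2) unfolding almost_periodic_in_strip_def
        by (meson analytic_imp_holomorphic holomorphic_on_subset)
      have "f s \<noteq> 0" if "c < Re s" "Re s < d" for s
        using \<delta>(2)[of "Re s"] strip[OF that] that by (auto simp: c_def d_def dist_real_def)
      then show False
        using nonzero_on_strip_imp_not_tendsto_0[OF holo _ cd(2,3)] t by blast
    qed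
    then show "\<sigma>\<^sub>0 \<in> R_set f \<alpha> \<beta>"
      using assms(3,4) by (simp add: R_set_def)
  qed
qed

end
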